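(* Let $n$ and $k$ be positive integers. Then $$(n!!)^{k!!}+n^k=(k!!)^{n!!}+k^n$$ holds if and only if $k=n$.
   Context: For a positive integer $m$, the double factorial $m!!$ is the product of all positive integers $\le m$ having the same parity as $m$, i.e. $m!!=m(m-2)(m-4)\cdots$, ending in $1$ if $m$ is odd and in $2$ if $m$ is even. *)

theory Defs
  imports Complex_Main
begin

definition double_fact :: "nat \<Rightarrow> nat" where
  "double_fact m = \<Prod>{j. 1 \<le> j \<and> j \<le> m \<and> (even j \<longleftrightarrow> even m)}"

end

theory Submission
  imports Defs
begin

text \<open>
  The factor \<open>(1 + 1/y) ^ x\<close> relating \<open>y ^ x\<close> to \<open>(y + 1) ^ x\<close> is less than \<open>e < 3\<close> when
  \<open>x \<le> y\<close>, so \<open>y ^ x < x ^ y\<close> for \<open>3 \<le> x < y\<close>. Since the double factorial is strictly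
  increasing on the positive integers, this applies both to \<open>(n, k)\<close> and to \<open>(n!!, k!!)\<close> when
  \<open>3 \<le> n < k\<close>, and the left-hand side exceeds the right-hand side.
  For \<open>n = 2\<close> the same swap of base and exponent only works from \<open>k = 5\<close> on.
\<close>

lemma double_fact_0: "double_fact 0 = 1"
proof -
  have "{j::nat. 1 \<le> j \<and> j \<le> 0 \<and> (even j \<longleftrightarrow> even (0::nat))} = {}"
    by auto
  then show ?thesis
    by (simp only: double_fact_def prod.empty)
qed

lemma double_fact_1: "double_fact (Suc 0) = 1"
proof -
  have "{j::nat. 1 \<le> j \<and> j \<le> Suc 0 \<and> (even j \<longleftrightarrow> even (Suc 0))} = {1}"
    by (auto simp: le_Suc_eq)
  then show ?thesis
    by (simp add: double_fact_def)
qed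

lemma double_fact_Suc_Suc: "double_fact (Suc (Suc m)) = Suc (Suc m) * double_fact m"
proof -
  let ?S = "\<lambda>m. {j::nat. 1 \<le> j \<and> j \<le> m \<and> (even j \<longleftrightarrow> even m)}"
  have "?S (Suc (Suc m)) = insert (Suc (Suc m)) (?S m)"
    by (auto simp: le_Suc_eq)
  moreover have "finite (?S m)"
    by (rule finite_subset[of _ "{..m}"]) auto
  ultimately show ?thesis
    unfolding double_fact_def by simp
qed

lemmas double_fact_simps = double_fact_0 double_fact_1 double_fact_Suc_Suc

lemma double_fact_numeral: "double_fact 2 = 2" "double_fact 3 = 3" "double_fact 4 = 8"
proof -
  show two: "double_fact 2 = 2"
    using double_fact_Suc_Suc[of 0] by (simp add: double_fact_0 numeral_2_eq_2)
  show "double_fact 3 = 3"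
    using double_fact_Suc_Suc[of 1] by (simp add: double_fact_1 numeral_3_eq_3)
  show "double_fact 4 = 8"
    using double_fact_Suc_Suc[of 2] by (simp add: two)
qed

lemma double_fact_less_Suc: "m > 0 \<Longrightarrow> double_fact m < double_fact (Suc m)"
proof (induction m rule: induct_nat_012)
  case (ge2 m)
  show ?case
  \<comment> \<open>Since 0!! = 1!! = 1, strictness fails at 0 and the induction hypothesis says
    nothing there; the goal is then just 2 < 3.\<close>
  proof (cases "m = 0")
    case False
    then have "double_fact m < double_fact (Suc m)"
      using ge2 by blast
    then show ?thesis
      unfolding double_fact_Suc_Suc by (intro mult_strict_mono) auto
  qed (simp add: double_fact_simps)
qed (simp_all add: double_fact_simps)

lemma double_fact_strict_mono: "0 < m \<Longrightarrow> m < n \<Longrightarrow> double_fact m < double_fact n"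
proof (induction n)
  case (Suc n)
  then show ?case
    by (metis double_fact_less_Suc less_SucE less_trans)
qed simp

lemma Suc_power_less_three_times:
  fixes x y :: nat
  assumes "0 < x" "x \<le> y"
  shows "Suc y ^ x < 3 * y ^ x"
proof -
  have y: "y > 0"
    using assms by simp
  \<comment> \<open>Strictness enters here, from \<open>1 + t < exp t\<close> for nonzero
    \<open>t\<close>, and survives the power because \<open>0 < x\<close>; the later bounds are
    weak.\<close>
  have "1 + 1 / real y < exp (1 / real y)"
    using y exp_minus_greater[of "- (1 / real y)"] by simp
  then have "(1 + 1 / real y) ^ x < exp (1 / real y) ^ x"
    using assms by (intro power_strict_mono) auto
  also have "\<dots> = exp (real x / real y)"
    by (metis exp_of_nat_mult times_divide_eq_right mult.right_neutral)
  also have "\<dots> \<le> exp 1"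
    using assms y by simp
  also have "\<dots> \<le> 3"
    by (rule exp_le)
  finally have "(1 + 1 / real y) ^ x < 3" .
  moreover have "real (Suc y) = (1 + 1 / real y) * real y"
    using y by (simp add: field_simps)
  ultimately have "real (Suc y) ^ x < 3 * real y ^ x"
    using y by (simp only: power_mult_distrib) simp
  then have "real (Suc y ^ x) < real (3 * y ^ x)"
    by (simp only: of_nat_power of_nat_mult of_nat_numeral)
  then show ?thesis
    by (simp only: of_nat_less_iff)
qed

lemma power_less_power_swap:
  fixes x y :: nat
  assumes "3 \<le> x" "x < y"
  shows "y ^ x < x ^ y"
proof -
  \<comment> \<open>The premise is weak so that the step also applies at \<open>z = x\<close>, where
    both powers agree; this yields the base case \<open>y = Suc x\<close>.\<close>
  have step: "Suc z ^ x < x ^ Suc z" if "x \<le> z" "z ^ x \<le> x ^ z" for z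
  proof -
    have "Suc z ^ x < 3 * z ^ x"
      using assms that by (intro Suc_power_less_three_times) auto
    also have "\<dots> \<le> x * x ^ z"
      using assms that by (intro mult_mono) auto
    finally show ?thesis
      by simp
  qed
  from \<open>x < y\<close> have "Suc x \<le> y" by simp
  then show ?thesis
    by (induction y rule: dec_induct) (use step in auto)
qed

lemma square_less_power_2:
  fixes m :: nat
  assumes "4 < m"
  shows "m ^ 2 < 2 ^ m"
proof -
  from assms have "5 \<le> m" by simp
  then show ?thesis
  proof (induction m rule: dec_induct)
    case (step j)
    \<comment> \<open>This absorbs the linear part of the square:
      \<open>2 * j + 1 \<le> 3 * j \<le> j * j\<close>.\<close>
    have "3 * j \<le> j * j"
      using step by (intro mult_right_mono) auto
    moreover have "Suc j ^ 2 = j * j + 2 * j + 1"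
      by (simp add: power2_eq_square)
    ultimately have "Suc j ^ 2 \<le> 2 * j ^ 2"
      using step.hyps by (simp only: power2_eq_square)
    also have "\<dots> < 2 ^ Suc j"
      using step.IH by simp
    finally show ?case .
  qed simp
qed

lemma double_fact_power_sum_neq:
  assumes "0 < n" "n < k"
  shows "double_fact n ^ double_fact k + n ^ k \<noteq> double_fact k ^ double_fact n + k ^ n"
proof -
  \<comment> \<open>For \<open>n = 2\<close> the swap reverses at \<open>k = 3\<close> (8 < 9) and
    ties at \<open>k = 4\<close> (16 = 16), so these two pairs are evaluated directly.\<close>
  consider "n = 1" | "n = 2" "k = 3" | "n = 2" "k = 4" | "n = 2" "k > 4" | "n \<ge> 3"
    using assms by linarith
  then show ?thesis
  proof cases
    case 1
    \<comment> \<open>The left side is 1 + 1, while both summands \<open>double_fact k\<close> and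
      \<open>k\<close> on the right exceed 1.\<close>
    then show ?thesis
      using assms double_fact_strict_mono[of 1 k] by (simp add: double_fact_simps)
  next
    case 2
    then show ?thesis
      by (simp add: double_fact_numeral)
  next
    case 3
    then show ?thesis
      by (simp add: double_fact_numeral)
  next
    case 4
    have "8 < double_fact k"
      using 4 double_fact_strict_mono[of 4 k] by (simp add: double_fact_numeral)
    then have "double_fact k ^ 2 < 2 ^ double_fact k"
      by (intro square_less_power_2) simp
    then show ?thesis
      using 4 square_less_power_2[of k] by (simp add: double_fact_numeral)
  next
    case 5
    have "3 \<le> double_fact n"
      using 5 double_fact_strict_mono[of 3 n] by (cases "n = 3") (auto simp: double_fact_numeral)
    then have "double_fact k ^ double_fact n < double_fact n ^ double_fact k"
      using assms by (intro power_less_power_swap double_fact_strict_mono)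
    moreover have "k ^ n < n ^ k"
      using 5 assms by (intro power_less_power_swap)
    ultimately show ?thesis
      by simp
  qed
qed

theorem theorem1p5:
  fixes n k :: nat
  assumes "n > 0" and "k > 0"
  shows "double_fact n ^ double_fact k + n ^ k = double_fact k ^ double_fact n + k ^ n \<longleftrightarrow> k = n"
  \<comment> \<open>Exchanging \<open>n\<close> and \<open>k\<close> only exchanges the two sides,
    so the ordered case covers both strict orders.\<close>
  using double_fact_power_sum_neq[of n k] double_fact_power_sum_neq[of k n] assms
  by (cases n k rule: linorder_cases) auto

end
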